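(* Let $n,m\ge3$ be odd integers and let $S$ and $T$ be 2-partitions of $\mathbb{Z}_n^*$ and $\mathbb{Z}_m^*$ respectively, and let $W_{ST}$ be any product of $S$ and $T$. Then $W_{ST}$ is a starter in $\mathbb{Z}_{mn}$ if and only if $S$ is a starter in $\mathbb{Z}_n$ and $T$ is a starter in $\mathbb{Z}_m$.
   Context: $\mathbb{Z}_k^*=\mathbb{Z}_k\setminus\{0\}$; a 2-partition of $\mathbb{Z}_k^*$ ($k$ odd) is a partition into unordered pairs $\{x_i,y_i\}$; it is a starter in $\mathbb{Z}_k$ if $\{\pm(x_i-y_i)\bmod k\}=\mathbb{Z}_k^*$. Product: let $n=2q+1$, $m=2p+1$. Let $\tilde S$ be any set of ordered pairs obtained by ordering each pair of $S$ in either way. Let $\bar T=\{(r_j,t_j)\}_{j=1}^p$ be obtained by ordering each pair of $T$ so that $\bigcup_j\{\pm r_j\}=\mathbb{Z}_m^*$, and $\bar T'=\{(-r_j,-t_j)\}_{j=1}^p$. A product $W_{ST}$ is the collection of unordered pairs $\{nr+x,\ nt+y\}$ (mod $nm$, with $x,y$ represented in $\{0,\dots,n-1\}$) of two types: (i) one pair for each $(r,t)\in\bar T\cup\bar T'\cup\{(0,0)\}$ and each $(x,y)\in\tilde S$; (ii) one pair for each $(r,t)\in\bar T$ with $x=y=0$. *)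

theory Defs
  imports Main "HOL-Library.Disjoint_Sets"
begin

text \<open>Residues modulo \<open>k\<close> are represented by the integers in \<open>{0..<k}\<close>, and unordered pairs
  by two-element sets.\<close>

definition Zstar :: "int \<Rightarrow> int set" where
  "Zstar k = {0..<k} - {0}"

definition two_partition :: "int \<Rightarrow> int set set \<Rightarrow> bool" where
  "two_partition k P \<longleftrightarrow> partition_on (Zstar k) P \<and> (\<forall>A\<in>P. card A = 2)"

definition starter :: "int \<Rightarrow> int set set \<Rightarrow> bool" where
  "starter k P \<longleftrightarrow> two_partition k P \<and>
     {d. \<exists>x y. {x, y} \<in> P \<and> (d = (x - y) mod k \<or> d = (- (x - y)) mod k)} = Zstar k"

text \<open>\<open>R\<close> arises from \<open>P\<close> by ordering each pair in one of the two possible ways: forgetting the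
  order is a bijection from \<open>R\<close> onto \<open>P\<close>, so no pair occurs in \<open>R\<close> in both orders.\<close>

definition ordering_of_pairs :: "int set set \<Rightarrow> (int \<times> int) set \<Rightarrow> bool" where
  "ordering_of_pairs P R \<longleftrightarrow> bij_betw (\<lambda>(x, y). {x, y}) R P"

definition half_ordering_of_pairs :: "int \<Rightarrow> int set set \<Rightarrow> (int \<times> int) set \<Rightarrow> bool" where
  "half_ordering_of_pairs m T R \<longleftrightarrow> ordering_of_pairs T R \<and>
     {a. \<exists>(r, t)\<in>R. a = r mod m \<or> a = (- r) mod m} = Zstar m"

definition neg_pairs :: "int \<Rightarrow> (int \<times> int) set \<Rightarrow> (int \<times> int) set" where
  "neg_pairs m R = (\<lambda>(r, t). ((- r) mod m, (- t) mod m)) ` R"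

definition product_pairs ::
    "int \<Rightarrow> int \<Rightarrow> (int \<times> int) set \<Rightarrow> (int \<times> int) set \<Rightarrow> int set set" where
  "product_pairs n m So To =
     {{(n * r + x) mod (n * m), (n * t + y) mod (n * m)} | r t x y.
        (r, t) \<in> To \<union> neg_pairs m To \<union> {(0, 0)} \<and> (x, y) \<in> So} \<union>
     {{(n * r) mod (n * m), (n * t) mod (n * m)} | r t. (r, t) \<in> To}"

text \<open>A product depends on the chosen orderings, so being a product of \<open>S\<close> and \<open>T\<close> is a
  relation.\<close>

definition is_product :: "int \<Rightarrow> int \<Rightarrow> int set set \<Rightarrow> int set set \<Rightarrow> int set set \<Rightarrow> bool" where
  "is_product n m S T W \<longleftrightarrow>
     (\<exists>So To. ordering_of_pairs S So \<and> half_ordering_of_pairs m T To \<and>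
        W = product_pairs n m So To)"

end

(* An element of Z_(nm) is n*r + x with r in Z_m and x in Z_n. The pairs of a product, in
   whichever order, cover Z_(nm) - {0}, and there are just (nm - 1)/2 of them, so they form a
   2-partition without any further disjointness argument. A difference of a product is either
   n*(r - t) + (x - y) with x - y nonzero modulo n, or n*(r - t). Reducing the differences modulo n
   therefore recovers the differences of S, and the differences divisible by n are n times those
   of T. *)

theory Submission
  imports Defs
begin

section \<open>Tight covers of a finite set by two maps\<close>

text \<open>The chain \<open>card Z \<le> card (f\<close> I \<union> g
  \<open>I) \<le> card (f\<close> I) + card (g \<open>I) \<le> 2 * card I \<le> card Z\<close>
  closes up, so each inequality in it is an equality. Equality at each place excludes one defect: a
  value outside \<open>Z\<close>, a value common to both maps, or a repetition within one
  map.\<close>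

lemma tight_cover:
  assumes fin: "finite I" and cov: "Z \<subseteq> f ` I \<union> g ` I" and le: "2 * card I \<le> card Z"
  shows "f ` I \<union> g ` I = Z" "inj_on f I" "inj_on g I" "f ` I \<inter> g ` I = {}"
proof -
  have a: "card (f ` I) \<le> card I" "card (g ` I) \<le> card I"
    using fin by (auto intro: card_image_le)
  have b: "card (f ` I) + card (g ` I) = card (f ` I \<union> g ` I) + card (f ` I \<inter> g ` I)"
    using fin by (intro card_Un_Int) auto
  have c: "card Z \<le> card (f ` I \<union> g ` I)"
    using fin cov by (intro card_mono) auto
  have "card (f ` I) = card I" "card (g ` I) = card I" "card (f ` I \<inter> g ` I) = 0"
    and d: "card (f ` I \<union> g ` I) = card Z"
    using a b c le by linarith+
  then show "inj_on f I" "inj_on g I" "f ` I \<inter> g ` I = {}"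
    using fin by (auto intro: eq_card_imp_inj_on)
  show "f ` I \<union> g ` I = Z"
    using card_subset_eq[OF _ cov] d fin by simp
qed

text \<open>Tightness makes all \<open>2 * card I\<close> values distinct, so pairs with different
  indices cannot meet and no pair collapses to a singleton. A count and a cover are thus enough to
  recognise a 2-partition.\<close>

lemma tight_cover_partition:
  assumes "finite I" and "Z \<subseteq> f ` I \<union> g ` I" and "2 * card I \<le> card Z"
  shows "partition_on Z ((\<lambda>i. {f i, g i}) ` I)" "\<forall>A \<in> (\<lambda>i. {f i, g i}) ` I. card A = 2"
proof -
  note t = tight_cover[OF assms]
  have ne: "f i \<noteq> g j" if "i \<in> I" "j \<in> I" for i j
    using t(4) that by blast
  show "partition_on Z ((\<lambda>i. {f i, g i}) ` I)"
  proof (rule partition_onI)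
    show "\<Union> ((\<lambda>i. {f i, g i}) ` I) = Z"
      using t(1) by auto
    fix p q assume "p \<in> (\<lambda>i. {f i, g i}) ` I" "q \<in> (\<lambda>i. {f i, g i}) ` I" "p \<noteq> q"
    then obtain i j where ij: "i \<in> I" "j \<in> I" "p = {f i, g i}" "q = {f j, g j}" "i \<noteq> j"
      by auto
    then have "f i \<noteq> f j" "g i \<noteq> g j"
      using t(2,3) by (auto dest: inj_onD)
    then show "disjnt p q"
      using ij ne[of i j] ne[of j i] by (auto simp: disjnt_def)
  qed auto
  show "\<forall>A \<in> (\<lambda>i. {f i, g i}) ` I. card A = 2"
    using ne by auto
qed

section \<open>Nonzero residues, 2-partitions and a divisibility criterion for starters\<close>

lemma finite_Zstar [simp]: "finite (Zstar k)"
  by (simp add: Zstar_def)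

lemma card_Zstar: "1 \<le> k \<Longrightarrow> int (card (Zstar k)) = k - 1"
  by (simp add: Zstar_def card_Diff_singleton)

lemma mod_in_Zstar_iff: "k > 0 \<Longrightarrow> a mod k \<in> Zstar k \<longleftrightarrow> \<not> k dvd a"
  by (auto simp: Zstar_def dvd_eq_mod_eq_0)

lemma not_dvd_Zstar: "a \<in> Zstar k \<Longrightarrow> \<not> k dvd a"
  by (auto simp: Zstar_def dest: zdvd_imp_le)

lemma not_dvd_diff_Zstar:
  assumes "x \<in> Zstar k" "y \<in> Zstar k" "x \<noteq> y"
  shows "\<not> k dvd (x - y)"
proof
  assume "k dvd x - y"
  then have "x mod k = y mod k"
    by (simp add: mod_eq_dvd_iff)
  then show False
    using assms by (simp add: Zstar_def)
qed

lemma two_partition_Zstar: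
  assumes "two_partition k P" "{x, y} \<in> P"
  shows "x \<in> Zstar k" "y \<in> Zstar k" "x \<noteq> y"
proof -
  have "{x, y} \<subseteq> Zstar k"
    using assms unfolding two_partition_def partition_on_def by blast
  then show "x \<in> Zstar k" "y \<in> Zstar k"
    by auto
  have "card {x, y} = 2"
    using assms unfolding two_partition_def by blast
  then show "x \<noteq> y"
    by auto
qed

lemma two_partition_card:
  assumes "two_partition k P"
  shows "finite P" "2 * card P = card (Zstar k)"
proof -
  have p: "partition_on (Zstar k) P" and c: "\<forall>A\<in>P. card A = 2"
    using assms by (auto simp: two_partition_def)
  have U: "\<Union>P = Zstar k"
    using p by (simp add: partition_on_def)
  then show fin: "finite P"
    by (metis finite_UnionD finite_Zstar)
  have "2 * card P = card (\<Union>P)"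
    using fin U c p by (intro card_partition) (auto simp: partition_on_def disjoint_def)
  then show "2 * card P = card (Zstar k)"
    by (simp add: U)
qed

text \<open>The entries of a pair are distinct residues, so differences are never divisible by
  \<open>k\<close>, and only the covering half of the starter condition has content. The entries
  \<open>f i\<close>, \<open>g i\<close> stay unreduced so that later computations take place in the
  integers, with divisibility in place of \<open>mod\<close>.\<close>

lemma starter_iff:
  assumes "k > 0" and tp: "two_partition k P" and P: "P = (\<lambda>i. {f i mod k, g i mod k}) ` I"
  shows "starter k P \<longleftrightarrow>
    (\<forall>d. \<not> k dvd d \<longrightarrow> (\<exists>i\<in>I. k dvd (d - (f i - g i)) \<or> k dvd (d + (f i - g i))))"
    (is "_ \<longleftrightarrow> (\<forall>d. _ \<longrightarrow> ?Q d)")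
proof -
  define D where "D = {d. \<exists>x y. {x, y} \<in> P \<and> (d = (x - y) mod k \<or> d = (- (x - y)) mod k)}"
  have sub: "D \<subseteq> Zstar k"
  proof
    fix d assume "d \<in> D"
    then obtain x y where xy: "{x, y} \<in> P" "d = (x - y) mod k \<or> d = (- (x - y)) mod k"
      by (auto simp: D_def)
    have "\<not> k dvd (x - y)"
      using not_dvd_diff_Zstar two_partition_Zstar[OF tp xy(1)] by blast
    moreover from this have "\<not> k dvd - (x - y)"
      by (simp only: dvd_minus_iff not_False_eq_True)
    ultimately show "d \<in> Zstar k"
      using xy(2) \<open>k > 0\<close> by (auto simp only: mod_in_Zstar_iff)
  qed
  have mem: "d mod k \<in> D \<longleftrightarrow> ?Q d" for d
  proof -
    have "d mod k \<in> D \<longleftrightarrow>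
      (\<exists>i\<in>I. d mod k = (f i - g i) mod k \<or> d mod k = (- (f i - g i)) mod k)"
    proof
      assume "d mod k \<in> D"
      then obtain x y i where "i \<in> I" "{x, y} = {f i mod k, g i mod k}"
        "d mod k = (x - y) mod k \<or> d mod k = (- (x - y)) mod k"
        by (auto simp: D_def P)
      \<comment> \<open>Equality of unordered pairs leaves two matchings of the entries; the second
        one only flips the sign of the difference, which exchanges the two alternatives.\<close>
      then show "\<exists>i\<in>I. d mod k = (f i - g i) mod k \<or> d mod k = (- (f i - g i)) mod k"
        by (intro bexI[of _ i]) (auto simp: doubleton_eq_iff mod_simps)
    next
      assume "\<exists>i\<in>I. d mod k = (f i - g i) mod k \<or> d mod k = (- (f i - g i)) mod k"
      then obtain i where "i \<in> I"
        "d mod k = (f i - g i) mod k \<or> d mod k = (- (f i - g i)) mod k"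
        by blast
      moreover have "{f i mod k, g i mod k} \<in> P"
        using \<open>i \<in> I\<close> P by blast
      ultimately show "d mod k \<in> D"
        unfolding D_def mem_Collect_eq
        by (intro exI[of _ "f i mod k"] exI[of _ "g i mod k"]) (auto simp: mod_simps)
    qed
    then show ?thesis
      by (simp only: mod_eq_dvd_iff diff_minus_eq_add)
  qed
  have "starter k P \<longleftrightarrow> Zstar k \<subseteq> D"
    using sub tp unfolding starter_def D_def[symmetric] by blast
  also have "\<dots> \<longleftrightarrow> (\<forall>d. \<not> k dvd d \<longrightarrow> d mod k \<in> D)"
  proof
    assume "Zstar k \<subseteq> D"
    then show "\<forall>d. \<not> k dvd d \<longrightarrow> d mod k \<in> D"
      using mod_in_Zstar_iff[OF \<open>k > 0\<close>] by blast
  next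
    assume r: "\<forall>d. \<not> k dvd d \<longrightarrow> d mod k \<in> D"
    show "Zstar k \<subseteq> D"
    proof
      fix d assume d: "d \<in> Zstar k"
      then have "d mod k = d"
        by (simp add: Zstar_def)
      then show "d \<in> D"
        using r not_dvd_Zstar[OF d] by metis
    qed
  qed
  finally show ?thesis
    by (simp only: mem)
qed

section \<open>Ordered versions of 2-partitions\<close>

lemma ordering_of_pairs_image:
  assumes "ordering_of_pairs P R"
  shows "P = (\<lambda>(x, y). {x, y}) ` R"
  using assms by (simp add: ordering_of_pairs_def bij_betw_def)

lemma ordering_of_pairs_props:
  assumes tp: "two_partition k P" and R: "ordering_of_pairs P R"
  shows "finite R" "2 * card R = card (Zstar k)"
    and "\<And>x y. (x, y) \<in> R \<Longrightarrow> x \<in> Zstar k \<and> y \<in> Zstar k \<and> x \<noteq> y"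
    and "\<And>a. a \<in> Zstar k \<Longrightarrow> \<exists>(x, y)\<in>R. a = x \<or> a = y"
    and "P = (\<lambda>i. {fst i mod k, snd i mod k}) ` R"
proof -
  note im = ordering_of_pairs_image[OF R]
  have bij: "bij_betw (\<lambda>(x, y). {x, y}) R P"
    using R by (simp add: ordering_of_pairs_def)
  show "finite R"
    using bij two_partition_card(1)[OF tp] by (simp add: bij_betw_finite)
  show "2 * card R = card (Zstar k)"
    using bij_betw_same_card[OF bij] two_partition_card(2)[OF tp] by simp
  show Z: "x \<in> Zstar k \<and> y \<in> Zstar k \<and> x \<noteq> y" if "(x, y) \<in> R" for x y
  proof -
    have "{x, y} \<in> P"
      using im that by force
    then show ?thesis
      using two_partition_Zstar[OF tp] by blast
  qed
  show "\<exists>(x, y)\<in>R. a = x \<or> a = y" if "a \<in> Zstar k" for a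
  proof -
    have "a \<in> \<Union>P"
      using that tp by (simp add: two_partition_def partition_on_def)
    then show ?thesis
      by (force simp: im)
  qed
  have "P = (\<lambda>i. {fst i, snd i}) ` R"
    by (simp add: im case_prod_unfold)
  \<comment> \<open>Entries are their own representatives, so the reduction changes nothing; it
    gives \<open>P\<close> the shape that \<open>starter_iff\<close> expects.\<close>
  also have "\<dots> = (\<lambda>i. {fst i mod k, snd i mod k}) ` R"
    using Z by (intro image_cong refl) (auto simp: Zstar_def)
  finally show "P = (\<lambda>i. {fst i mod k, snd i mod k}) ` R" .
qed

text \<open>The second coordinates form a half-set too: if neither \<open>a\<close> nor \<open>-a\<close> were a second
  coordinate, both would be first coordinates, which a tight cover by \<open>\<plusminus>r\<close> excludes.\<close>

lemma half_ordering_cover: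
  assumes "m > 0" and tp: "two_partition m T" and R: "half_ordering_of_pairs m T R"
    and a: "a \<in> Zstar m"
  shows "\<exists>(r, t)\<in>R. a = r mod m \<or> a = (- r) mod m"
    and "\<exists>(r, t)\<in>R. a = t mod m \<or> a = (- t) mod m"
proof -
  have ord: "ordering_of_pairs T R"
    and cov: "{a. \<exists>(r, t)\<in>R. a = r mod m \<or> a = (- r) mod m} = Zstar m"
    using R by (auto simp: half_ordering_of_pairs_def)
  note op = ordering_of_pairs_props[OF tp ord]
  show "\<exists>(r, t)\<in>R. a = r mod m \<or> a = (- r) mod m"
    using a cov by blast
  show "\<exists>(r, t)\<in>R. a = t mod m \<or> a = (- t) mod m"
  proof (rule ccontr)
    assume neg: "\<not> ?thesis"
    define b where "b = (- a) mod m"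
    have b: "b \<in> Zstar m"
      unfolding b_def using not_dvd_Zstar[OF a] \<open>m > 0\<close> by (simp add: mod_in_Zstar_iff)
    have am: "a mod m = a"
      using a by (simp add: Zstar_def)
    have bm: "(- b) mod m = a"
      using am by (simp add: b_def mod_simps)
    obtain r1 t1 where 1: "(r1, t1) \<in> R" "a = r1 \<or> a = t1"
      using op(4)[OF a] by blast
    obtain r2 t2 where 2: "(r2, t2) \<in> R" "b = r2 \<or> b = t2"
      using op(4)[OF b] by blast
    have "a = r1"
      using 1 am neg by auto
    moreover have "b = r2"
      using 2 bm neg by auto
    moreover have "(\<lambda>i. fst i mod m) ` R \<inter> (\<lambda>i. (- fst i) mod m) ` R = {}"
      by (rule tight_cover(4)[where Z = "Zstar m"])
        (use op(1,2) cov in \<open>force+\<close>)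
    ultimately show False
      using 1(1) 2(1) am bm by force
  qed
qed

section \<open>Ordered pairs of T together with their negatives and the origin\<close>

definition signed_pairs :: "int \<Rightarrow> (int \<times> int) set \<Rightarrow> (int \<times> int) set" where
  "signed_pairs m R = R \<union> neg_pairs m R \<union> {(0, 0)}"

lemma neg_pairs_memI: "(r, t) \<in> R \<Longrightarrow> ((- r) mod m, (- t) mod m) \<in> neg_pairs m R"
  by (force simp: neg_pairs_def)

text \<open>An upper bound suffices, since \<open>tight_cover\<close> asks only for
  \<open>2 * card I \<le> card Z\<close>; overlaps among the three parts could only lower the
  count.\<close>

lemma card_signed_pairs:
  assumes "finite R"
  shows "finite (signed_pairs m R)" "card (signed_pairs m R) \<le> 2 * card R + 1"
proof -
  show "finite (signed_pairs m R)"
    using assms by (simp add: signed_pairs_def neg_pairs_def)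
  have "card (neg_pairs m R) \<le> card R"
    unfolding neg_pairs_def using assms by (rule card_image_le)
  moreover have "card (signed_pairs m R) \<le> card (R \<union> neg_pairs m R) + card {(0::int, 0::int)}"
    unfolding signed_pairs_def by (rule card_Un_le)
  moreover have "card (R \<union> neg_pairs m R) \<le> card R + card (neg_pairs m R)"
    by (rule card_Un_le)
  ultimately show "card (signed_pairs m R) \<le> 2 * card R + 1"
    by simp
qed

text \<open>Up to sign, the first coordinates of \<open>R\<close> cover the nonzero residues by the
  choice of the half ordering, and the second coordinates do so by
  \<open>half_ordering_cover\<close>; the origin supplies 0. This lets any leading digit
  \<open>b\<close> be combined with a given last digit, whichever position the latter has in its
  pair.\<close>

lemma signed_pairs_cover:
  assumes "m > 0" and tp: "two_partition m T" and R: "half_ordering_of_pairs m T R"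
    and b: "b \<in> {0..<m}"
  shows "\<exists>t. (b, t) \<in> signed_pairs m R" "\<exists>r. (r, b) \<in> signed_pairs m R"
proof -
  have ord: "ordering_of_pairs T R"
    using R by (auto simp: half_ordering_of_pairs_def)
  have Rm: "r mod m = r \<and> t mod m = t" if "(r, t) \<in> R" for r t
    using ordering_of_pairs_props(3)[OF tp ord that] by (auto simp: Zstar_def)
  have "(\<exists>t. (b, t) \<in> signed_pairs m R) \<and> (\<exists>r. (r, b) \<in> signed_pairs m R)"
  proof (cases "b = 0")
    case True
    then show ?thesis
      by (auto simp: signed_pairs_def)
  next
    case False
    then have "b \<in> Zstar m"
      using b by (simp add: Zstar_def)
    note cover = half_ordering_cover[OF \<open>m > 0\<close> tp R this]
    obtain r t where 1: "(r, t) \<in> R" "b = r mod m \<or> b = (- r) mod m"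
      using cover(1) by blast
    obtain r' t' where 2: "(r', t') \<in> R" "b = t' mod m \<or> b = (- t') mod m"
      using cover(2) by blast
    show ?thesis
      using 1(2) 2(2) Rm[OF 1(1)] Rm[OF 2(1)] 1(1) 2(1)
        neg_pairs_memI[OF 1(1), of m] neg_pairs_memI[OF 2(1), of m]
      by (auto simp: signed_pairs_def)
  qed
  then show "\<exists>t. (b, t) \<in> signed_pairs m R" "\<exists>r. (r, b) \<in> signed_pairs m R"
    by auto
qed

text \<open>Negating a pair negates its difference and the origin has difference 0, so the two signs
  in the starter condition are absorbed into the index set and every residue is reached, 0
  included.\<close>

lemma signed_pairs_differences:
  assumes "m > 0" and tp: "two_partition m T" and ord: "ordering_of_pairs T R"
    and st: "starter m T"
  shows "\<exists>(r, t)\<in>signed_pairs m R. m dvd (e - (r - t))"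
proof (cases "m dvd e")
  case True
  then show ?thesis
    by (intro bexI[of _ "(0, 0)"]) (auto simp: signed_pairs_def)
next
  case False
  then obtain r t where rt: "(r, t) \<in> R" "m dvd (e - (r - t)) \<or> m dvd (e + (r - t))"
    using st starter_iff[OF \<open>m > 0\<close> tp ordering_of_pairs_props(5)[OF tp ord]] by fastforce
  show ?thesis
  proof (cases "m dvd (e - (r - t))")
    case True
    then show ?thesis
      using rt(1) by (intro bexI[of _ "(r, t)"]) (auto simp: signed_pairs_def)
  next
    case False
    then have "e mod m = (- (r - t)) mod m"
      using rt(2) by (simp add: mod_eq_dvd_iff algebra_simps)
    also have "\<dots> = ((- r) mod m - (- t) mod m) mod m"
      by (simp add: mod_simps)
    finally have "m dvd (e - ((- r) mod m - (- t) mod m))"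
      by (simp add: mod_eq_dvd_iff)
    then show ?thesis
      using neg_pairs_memI[OF rt(1), of m]
      by (intro bexI[of _ "((- r) mod m, (- t) mod m)"]) (auto simp: signed_pairs_def)
  qed
qed

section \<open>The product as an indexed family of pairs\<close>

text \<open>Pairs of type (ii) are indexed with last digits \<open>(0, 0)\<close>, so that one
  formula describes both types. When \<open>So\<close> orders a 2-partition of nonzero residues,
  \<open>(0, 0)\<close> is not in \<open>So\<close>, and the last digits tell the types
  apart.\<close>

definition product_index ::
    "int \<Rightarrow> (int \<times> int) set \<Rightarrow> (int \<times> int) set \<Rightarrow> ((int \<times> int) \<times> (int \<times> int)) set" where
  "product_index m So To = signed_pairs m To \<times> So \<union> To \<times> {(0, 0)}"

text \<open>The entries are taken before reduction modulo \<open>n * m\<close>, in the form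
  \<open>starter_iff\<close> uses.\<close>

definition product_fst :: "int \<Rightarrow> (int \<times> int) \<times> (int \<times> int) \<Rightarrow> int" where
  "product_fst n = (\<lambda>((r, t), (x, y)). n * r + x)"

definition product_snd :: "int \<Rightarrow> (int \<times> int) \<times> (int \<times> int) \<Rightarrow> int" where
  "product_snd n = (\<lambda>((r, t), (x, y)). n * t + y)"

lemma product_pairs_eq_image:
  "product_pairs n m So To =
     (\<lambda>i. {product_fst n i mod (n * m), product_snd n i mod (n * m)}) ` product_index m So To"
  (is "_ = ?F ` _")
proof -
  have "?F ` (signed_pairs m To \<times> So) =
      {{(n * r + x) mod (n * m), (n * t + y) mod (n * m)} | r t x y.
        (r, t) \<in> signed_pairs m To \<and> (x, y) \<in> So}"
    by (force simp: product_fst_def product_snd_def)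
  moreover have "?F ` (To \<times> {(0, 0)}) =
      {{(n * r) mod (n * m), (n * t) mod (n * m)} | r t. (r, t) \<in> To}"
    by (force simp: product_fst_def product_snd_def)
  ultimately show ?thesis
    by (simp only: product_pairs_def product_index_def image_Un signed_pairs_def)
qed

text \<open>The half ordering of \<open>T\<close> matters for the cover: a last digit
  \<open>x\<close> has a fixed position in its ordered pair of \<open>So\<close>, and the leading
  digit must be found in that same position.\<close>

lemma product_two_partition:
  assumes n: "n > 0" and m: "m > 0"
    and S: "two_partition n S" and T: "two_partition m T"
    and So: "ordering_of_pairs S So" and To: "half_ordering_of_pairs m T To"
  shows "two_partition (n * m) (product_pairs n m So To)"
proof -
  have ToT: "ordering_of_pairs T To"
    using To by (simp add: half_ordering_of_pairs_def)
  note s = ordering_of_pairs_props[OF S So] and t = ordering_of_pairs_props[OF T ToT]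
  define I where "I = product_index m So To"
  define f where "f i = product_fst n i mod (n * m)" for i
  define g where "g i = product_snd n i mod (n * m)" for i
  have fin: "finite I"
    using s(1) t(1) card_signed_pairs(1)[OF t(1)] by (simp add: I_def product_index_def)
  have "card I \<le> card (signed_pairs m To) * card So + card To"
    unfolding I_def product_index_def
    by (rule order.trans[OF card_Un_le]) (simp add: card_cartesian_product)
  also have "\<dots> \<le> (2 * card To + 1) * card So + card To"
    using card_signed_pairs(2)[OF t(1)] by (intro add_right_mono mult_right_mono) auto
  finally have "int (2 * card I) \<le> int (2 * ((2 * card To + 1) * card So + card To))"
    by (simp only: of_nat_le_iff mult_le_mono2)
  also have "\<dots> = (2 * int (card To) + 1) * (2 * int (card So)) + 2 * int (card To)"
    by (simp add: algebra_simps)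
  \<comment> \<open>Since \<open>2 * int (card So) = n - 1\<close> and
    \<open>2 * int (card To) = m - 1\<close>, the sum is
    \<open>m * (n - 1) + (m - 1) = n * m - 1\<close>. Working in \<open>int\<close> avoids truncated
    subtraction.\<close>
  also have "\<dots> = int (card (Zstar (n * m)))"
  proof -
    have halves: "2 * int (card So) = n - 1" "2 * int (card To) = m - 1"
      using s(2) t(2) card_Zstar[of n] card_Zstar[of m] n m by linarith+
    have "1 \<le> n * m"
      using n m by (simp add: int_one_le_iff_zero_less)
    then show ?thesis
      unfolding halves by (simp add: card_Zstar algebra_simps)
  qed
  finally have card: "2 * card I \<le> card (Zstar (n * m))"
    by linarith
  have cov: "Zstar (n * m) \<subseteq> f ` I \<union> g ` I"
  proof
    fix a assume a: "a \<in> Zstar (n * m)"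
    define b where "b = a div n"
    define x where "x = a mod n"
    have ab: "a = n * b + x" and am: "a mod (n * m) = a"
      using a by (simp_all add: b_def x_def Zstar_def)
    have b: "b \<in> {0..<m}"
    proof -
      have "n * b < n * m"
        using ab a pos_mod_sign[OF n, of a] by (auto simp: Zstar_def x_def)
      then have "b < m"
        using n by simp
      moreover have "0 \<le> b"
        using a n by (simp add: b_def Zstar_def pos_imp_zdiv_nonneg_iff)
      ultimately show ?thesis
        by simp
    qed
    show "a \<in> f ` I \<union> g ` I"
    proof (cases "x = 0")
      case True
      \<comment> \<open>With last digit 0, the leading digit is nonzero because \<open>a\<close> is,
        so it occurs in \<open>T\<close> and a pair of type (ii) contains \<open>a\<close>.\<close>
      then have "b \<in> Zstar m"
        using b ab a by (auto simp: Zstar_def)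
      then obtain r t where rt: "(r, t) \<in> To" "b = r \<or> b = t"
        using t(4) by blast
      then have "((r, t), (0, 0)) \<in> I"
        by (simp add: I_def product_index_def)
      moreover have "a = f ((r, t), (0, 0)) \<or> a = g ((r, t), (0, 0))"
        using rt(2) ab am True by (auto simp: f_def g_def product_fst_def product_snd_def)
      ultimately show ?thesis
        by blast
    next
      case False
      then have "x \<in> Zstar n"
        using n by (simp add: x_def Zstar_def)
      then obtain x1 y1 where xy: "(x1, y1) \<in> So" "x = x1 \<or> x = y1"
        using s(4) by blast
      \<comment> \<open>As \<open>x\<close> may be the first or the second entry of its pair, one
        pair with \<open>b\<close> first and one with \<open>b\<close> second are provided.\<close>
      obtain r1 t1 where r1: "(b, t1) \<in> signed_pairs m To" "(r1, b) \<in> signed_pairs m To"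
        using signed_pairs_cover[OF m T To b] by blast
      have "((b, t1), (x1, y1)) \<in> I" "((r1, b), (x1, y1)) \<in> I"
        using r1 xy(1) by (simp_all add: I_def product_index_def)
      moreover have "a = f ((b, t1), (x1, y1)) \<or> a = g ((r1, b), (x1, y1))"
        using xy(2) ab am by (auto simp: f_def g_def product_fst_def product_snd_def)
      ultimately show ?thesis
        by blast
    qed
  qed
  have "product_pairs n m So To = (\<lambda>i. {f i, g i}) ` I"
    by (simp add: product_pairs_eq_image I_def f_def g_def)
  then show ?thesis
    using tight_cover_partition[OF fin cov card] by (simp add: two_partition_def)
qed

section \<open>Differences of the product and the equivalence\<close>

text \<open>The product and both factors are 2-partitions, so \<open>starter_iff\<close> turns all
  three starter conditions into covering statements about differences, which are compared digit by
  digit.\<close>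

lemma product_starter_iff:
  assumes n: "n > 0" and m: "m > 0"
    and S: "two_partition n S" and T: "two_partition m T"
    and So: "ordering_of_pairs S So" and To: "half_ordering_of_pairs m T To"
  shows "starter (n * m) (product_pairs n m So To) \<longleftrightarrow> starter n S \<and> starter m T"
proof -
  have ToT: "ordering_of_pairs T To"
    using To by (simp add: half_ordering_of_pairs_def)
  note s = ordering_of_pairs_props[OF S So] and t = ordering_of_pairs_props[OF T ToT]
  have nm: "n * m > 0"
    using n m by simp
  define \<delta> where "\<delta> i = product_fst n i - product_snd n i" for i
  have \<delta>: "\<delta> ((r, t), (x, y)) = n * (r - t) + (x - y)" for r t x y
    by (simp add: \<delta>_def product_fst_def product_snd_def algebra_simps)
  have W: "starter (n * m) (product_pairs n m So To) \<longleftrightarrow>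
      (\<forall>d. \<not> n * m dvd d \<longrightarrow>
        (\<exists>i\<in>product_index m So To. n * m dvd (d - \<delta> i) \<or> n * m dvd (d + \<delta> i)))"
    unfolding \<delta>_def
    by (rule starter_iff[OF nm product_two_partition[OF n m S T So To] product_pairs_eq_image])
  note Siff = starter_iff[OF n S s(5)] and Tiff = starter_iff[OF m T t(5)]
  show ?thesis
  proof
    assume "starter (n * m) (product_pairs n m So To)"
    then have ex: "\<exists>i\<in>product_index m So To. n * m dvd (d - \<delta> i) \<or> n * m dvd (d + \<delta> i)"
      if "\<not> n * m dvd d" for d
      using W that by blast
    show "starter n S \<and> starter m T"
    proof
      show "starter n S"
        unfolding Siff
      proof (intro allI impI)
        fix d assume d: "\<not> n dvd d"
        then have "\<not> n * m dvd d"
          by (meson dvd_mult_left)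
        then obtain r t x y where i: "((r, t), (x, y)) \<in> product_index m So To"
          and "n * m dvd (d - \<delta> ((r, t), (x, y))) \<or> n * m dvd (d + \<delta> ((r, t), (x, y)))"
          using ex by fast
        then have "n dvd (d - (n * (r - t) + (x - y))) \<or> n dvd (d + (n * (r - t) + (x - y)))"
          unfolding \<delta> by (meson dvd_mult_left)
        then have *: "n dvd (d - (x - y)) \<or> n dvd (d + (x - y))"
        proof
          assume "n dvd (d - (n * (r - t) + (x - y)))"
          then have "n dvd (d - (n * (r - t) + (x - y))) + n * (r - t)"
            by (rule dvd_add) simp
          also have "\<dots> = d - (x - y)"
            by simp
          finally show ?thesis
            by (rule disjI1)
        next
          assume "n dvd (d + (n * (r - t) + (x - y)))"
          then have "n dvd (d + (n * (r - t) + (x - y))) - n * (r - t)"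
            by (rule dvd_diff) simp
          also have "\<dots> = d + (x - y)"
            by (simp add: algebra_simps)
          finally show ?thesis
            by (rule disjI2)
        qed
        \<comment> \<open>An index of type (ii) has \<open>x = y = 0\<close>, which would give
          \<open>n dvd d\<close>.\<close>
        have "(x, y) \<in> So"
          using i * d by (auto simp: product_index_def)
        then show "\<exists>i\<in>So. n dvd (d - (fst i - snd i)) \<or> n dvd (d + (fst i - snd i))"
          using * by force
      qed
      show "starter m T"
        unfolding Tiff
      proof (intro allI impI)
        fix d assume "\<not> m dvd d"
        \<comment> \<open>A residue \<open>d\<close> modulo \<open>m\<close> is tested through the
          difference \<open>n * d\<close> of the product.\<close>
        then have "\<not> n * m dvd n * d"
          using n by simp
        then obtain r t x y where i: "((r, t), (x, y)) \<in> product_index m So To"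
          and dv: "n * m dvd (n * d - (n * (r - t) + (x - y))) \<or>
            n * m dvd (n * d + (n * (r - t) + (x - y)))"
          using ex unfolding \<delta>[symmetric] by fast
        have "n dvd (x - y)"
          using dv
        proof
          assume "n * m dvd (n * d - (n * (r - t) + (x - y)))"
          then have "n dvd (n * d - (n * (r - t) + (x - y)))"
            by (rule dvd_mult_left)
          then have "n dvd n * (d - (r - t)) - (n * d - (n * (r - t) + (x - y)))"
            by (rule dvd_diff[OF dvd_triv_left])
          also have "\<dots> = x - y"
            by (simp add: algebra_simps)
          finally show ?thesis .
        next
          assume "n * m dvd (n * d + (n * (r - t) + (x - y)))"
          then have "n dvd (n * d + (n * (r - t) + (x - y)))"
            by (rule dvd_mult_left)
          then have "n dvd (n * d + (n * (r - t) + (x - y))) - n * (d + (r - t))"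
            by (rule dvd_diff) simp
          also have "\<dots> = x - y"
            by (simp add: algebra_simps)
          finally show ?thesis .
        qed
        \<comment> \<open>Pairs of \<open>So\<close> have distinct entries below \<open>n\<close>,
          whose difference \<open>n\<close> cannot divide. Hence the index is of type (ii), and the
          factor \<open>n\<close> cancels.\<close>
        then have "(x, y) \<notin> So"
          using s(3) not_dvd_diff_Zstar by blast
        then have rt: "(r, t) \<in> To" "x = 0" "y = 0"
          using i by (auto simp: product_index_def)
        then have "n * m dvd n * (d - (r - t)) \<or> n * m dvd n * (d + (r - t))"
          using dv by (simp add: algebra_simps)
        then have "m dvd (d - (r - t)) \<or> m dvd (d + (r - t))"
          using n by simp
        then show "\<exists>i\<in>To. m dvd (d - (fst i - snd i)) \<or> m dvd (d + (fst i - snd i))"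
          using rt(1) by force
      qed
    qed
  next
    assume st: "starter n S \<and> starter m T"
    show "starter (n * m) (product_pairs n m So To)"
      unfolding W
    proof (intro allI impI)
      fix d assume d: "\<not> n * m dvd d"
      show "\<exists>i\<in>product_index m So To. n * m dvd (d - \<delta> i) \<or> n * m dvd (d + \<delta> i)"
      proof (cases "n dvd d")
        case True
        then obtain e where e: "d = n * e" ..
        then have "\<not> m dvd e"
          using d by auto
        then obtain r t where rt: "(r, t) \<in> To" "m dvd (e - (r - t)) \<or> m dvd (e + (r - t))"
          using st Tiff by fastforce
        then have "n * m dvd n * (e - (r - t)) \<or> n * m dvd n * (e + (r - t))"
          by auto
        then have "n * m dvd (d - \<delta> ((r, t), (0, 0))) \<or> n * m dvd (d + \<delta> ((r, t), (0, 0)))"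
          by (simp add: e \<delta> algebra_simps)
        moreover have "((r, t), (0, 0)) \<in> product_index m So To"
          using rt(1) by (simp add: product_index_def)
        ultimately show ?thesis
          by blast
      next
        case False
        then obtain x y where xy: "(x, y) \<in> So" "n dvd (d - (x - y)) \<or> n dvd (d + (x - y))"
          using st Siff by fastforce
        have "\<exists>(r, t)\<in>signed_pairs m To.
          n * m dvd (d - \<delta> ((r, t), (x, y))) \<or> n * m dvd (d + \<delta> ((r, t), (x, y)))"
          using xy(2)
        proof
          assume "n dvd (d - (x - y))"
          \<comment> \<open>Here \<open>S\<close> has matched \<open>d\<close> modulo
            \<open>n\<close>, and \<open>e\<close> is the carry left over. It must be congruent to
            some \<open>r - t\<close> modulo \<open>m\<close>, with the same \<open>(x, y)\<close>
            kept.\<close>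
          then obtain e where e: "d - (x - y) = n * e" ..
          obtain r t where rt: "(r, t) \<in> signed_pairs m To" "m dvd (e - (r - t))"
            using signed_pairs_differences[OF m T ToT, of e] st by blast
          have "d - \<delta> ((r, t), (x, y)) = n * (e - (r - t))"
            using e unfolding \<delta> by (simp add: algebra_simps)
          then show ?thesis
            using rt by (intro bexI[of _ "(r, t)"]) simp_all
        next
          assume "n dvd (d + (x - y))"
          then obtain e where e: "d + (x - y) = n * e" ..
          obtain r t where rt: "(r, t) \<in> signed_pairs m To" "m dvd (- e - (r - t))"
            \<comment> \<open>In this case \<open>d + \<delta> ((r, t), (x, y))\<close> equals
              \<open>n * (e + (r - t))\<close>, so \<open>r - t\<close> has to match
              \<open>- e\<close>.\<close>
            using signed_pairs_differences[OF m T ToT, of "- e"] st by blast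
          have "d + \<delta> ((r, t), (x, y)) = n * - (- e - (r - t))"
            using e unfolding \<delta> by (simp add: algebra_simps)
          moreover have "m dvd - (- e - (r - t))"
            using rt(2) by (simp only: dvd_minus_iff)
          ultimately have "n * m dvd (d + \<delta> ((r, t), (x, y)))"
            by (metis dvd_refl mult_dvd_mono)
          then show ?thesis
            using rt by (intro bexI[of _ "(r, t)"]) simp_all
        qed
        then show ?thesis
          using xy(1) unfolding product_index_def by blast
      qed
    qed
  qed
qed

theorem theorem3p5:
  fixes n m :: int and S T W :: "int set set"
  assumes "n \<ge> 3" and "odd n" and "m \<ge> 3" and "odd m"
    and "two_partition n S" and "two_partition m T"
    and "is_product n m S T W"
  shows "starter (m * n) W \<longleftrightarrow> starter n S \<and> starter m T"
proof -
  obtain So To where "ordering_of_pairs S So" "half_ordering_of_pairs m T To"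
    and W: "W = product_pairs n m So To"
    using assms(7) unfolding is_product_def by blast
  then have "starter (n * m) W \<longleftrightarrow> starter n S \<and> starter m T"
    unfolding W using assms by (intro product_starter_iff) auto
  then show ?thesis
    by (simp only: mult.commute)
qed

end
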